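(* Let $M=\{m_1,\ldots,m_n\}$ be a finite set with $|M|=n$ and let $N=n(n-1)/2$. Consider the family of all binary trees $G$ connecting $M$. For each such tree $G$, let $W_G\subset\mathbb{R}^N$ be the associated polyhedron, let $V_G\subset\mathbb{R}^N$ be the set of vertices of $W_G$, and let $V=\bigcup_G V_G\subset\mathbb{R}^N$, where the union is over all binary trees $G$ connecting $M$. Then the set $V$ is extremal, that is, $V$ is exactly the set of vertices of its convex hull $\operatorname{conv} V\subset\mathbb{R}^N$.
   Context: Graphs are finite and simple; a tree is a connected graph without cycles. A binary tree connecting $M$ (equivalently, with boundary $M$) is a tree $G$ all of whose vertices have degree $1$ or $3$ and whose set of vertices of degree $1$ is exactly $M$. (Such trees exist only for $n\ge 2$, and each of them has exactly $2n-3$ edges.) For an edge $e$ of such a tree $G$, removing $e$ from $G$ leaves two disjoint trees $G_1$ and $G_2$. Let $M_k$ be the set of elements of $M$ that are vertices of $G_k$, $k=1,2$. Then $M=M_1\sqcup M_2$ is a partition of $M$, denoted $p(e)$. The coordinates of $\mathbb{R}^N$ are indexed by unordered pairs $ij=\{i,j\}$ with $1\le i\ne j\le n$, i.e. by the edges $\{m_i,m_j\}$ of the complete graph on $M$. The matrix $A_G$ has size $(2n-3)\times N$, its rows are indexed by the edges $e$ of $G$ and its columns by the pairs $ij$. Its entry $a^e_{ij}$ equals $1$ if $m_i$ and $m_j$ lie in different parts of the partition $p(e)$, and equals $0$ otherwise. The polyhedron of $G$ is $$W_G=\{\boldsymbol{x}\in\mathbb{R}^N : A_G\boldsymbol{x}=\mathbf{1}_{2n-3},\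 \boldsymbol{x}\ge 0\},$$ where $\mathbf{1}_k\in\mathbb{R}^k$ is the column vector of all ones and $\boldsymbol{x}\ge0$ means that all components are non-negative. A point $\boldsymbol{x}$ of a closed set $X\subset\mathbb{R}^N$ is called a vertex (extremal point, corner point) of $X$ if whenever $\boldsymbol{x}=(1-t)\boldsymbol{x}_0+t\boldsymbol{x}_1$ with $\boldsymbol{x}_0,\boldsymbol{x}_1\in X$ and $t\in(0,1)$, one has $\boldsymbol{x}_0=\boldsymbol{x}_1=\boldsymbol{x}$. *)

theory Defs
  imports "HOL-Analysis.Analysis" "HOL-Analysis.Finite_Function_Topology"
begin

section \<open>Finite simple graphs and trees\<close>

record 'v graph =
  verts :: "'v set"
  edges :: "'v set set"

definition simple_graph :: "'v graph \<Rightarrow> bool" where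
  "simple_graph G \<longleftrightarrow> finite (verts G) \<and> (\<forall>e\<in>edges G. e \<subseteq> verts G \<and> card e = 2)"

definition degree :: "'v graph \<Rightarrow> 'v \<Rightarrow> nat" where
  "degree G v = card {e \<in> edges G. v \<in> e}"

definition reachable :: "'v graph \<Rightarrow> 'v \<Rightarrow> 'v \<Rightarrow> bool" where
  "reachable G = (\<lambda>u v. {u, v} \<in> edges G)\<^sup>*\<^sup>*"

definition connected_graph :: "'v graph \<Rightarrow> bool" where
  "connected_graph G \<longleftrightarrow> verts G \<noteq> {} \<and> (\<forall>u\<in>verts G. \<forall>v\<in>verts G. reachable G u v)"

text \<open>The vertices of a cycle are listed once each; the closing edge joins the last to the first.\<close>

definition cycle :: "'v graph \<Rightarrow> 'v list \<Rightarrow> bool" where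
  "cycle G vs \<longleftrightarrow> 3 \<le> length vs \<and> distinct vs \<and>
     (\<forall>i. Suc i < length vs \<longrightarrow> {vs ! i, vs ! Suc i} \<in> edges G) \<and>
     {last vs, hd vs} \<in> edges G"

definition tree :: "'v graph \<Rightarrow> bool" where
  "tree G \<longleftrightarrow> simple_graph G \<and> connected_graph G \<and> \<not> (\<exists>vs. cycle G vs)"

definition remove_edge :: "'v graph \<Rightarrow> 'v set \<Rightarrow> 'v graph" where
  "remove_edge G e = \<lparr>verts = verts G, edges = edges G - {e}\<rparr>"

text \<open>Vertex sets of the connected components.\<close>

definition components :: "'v graph \<Rightarrow> 'v set set" where
  "components G = (\<lambda>u. {v \<in> verts G. reachable G u v}) ` verts G"


section \<open>Binary trees connecting a finite set\<close>

text \<open>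
  A tree connecting \<open>M\<close> has further vertices outside \<open>M\<close>. So that these are available whatever
  the type of the elements of \<open>M\<close> is, vertices are taken from a sum type: \<open>Inl m\<close> stands for
  the element \<open>m\<close> of \<open>M\<close>, and the summand \<open>nat\<close> supplies the vertices of degree 3.
\<close>

type_synonym 'a vertex = "'a + nat"

definition binary_tree_connecting :: "'a set \<Rightarrow> 'a vertex graph \<Rightarrow> bool" where
  "binary_tree_connecting M G \<longleftrightarrow> tree G \<and>
     (\<forall>v\<in>verts G. degree G v = 1 \<or> degree G v = 3) \<and>
     {v \<in> verts G. degree G v = 1} = Inl ` M"

definition edge_partition :: "'a set \<Rightarrow> 'a vertex graph \<Rightarrow> 'a vertex set \<Rightarrow> 'a set set" where
  "edge_partition M G e = (\<lambda>C. {m \<in> M. Inl m \<in> C}) ` components (remove_edge G e)"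


section \<open>The polyhedron of a binary tree\<close>

definition pairs :: "'a set \<Rightarrow> 'a set set" where
  "pairs M = {{u, v} |u v. u \<in> M \<and> v \<in> M \<and> u \<noteq> v}"

lemma card_pairs:
  assumes "finite M"
  shows "card (pairs M) = card M * (card M - 1) div 2"
proof -
  have "pairs M = {p. p \<subseteq> M \<and> card p = 2}"
    by (auto simp: pairs_def card_2_iff)
  then show ?thesis
    using n_subsets[OF assms, of 2] by (simp add: choose_two)
qed

text \<open>
  \<open>\<real>\<^sup>N\<close> is the space of real functions on \<open>pairs M\<close>, realised as the finitely supported functions
  with support in \<open>pairs M\<close>.
\<close>

definition pair_space :: "'a set \<Rightarrow> ('a set \<Rightarrow>\<^sub>0 real) set" where
  "pair_space M = {x. Poly_Mapping.keys x \<subseteq> pairs M}"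

definition matrix_entry ::
    "'a set \<Rightarrow> 'a vertex graph \<Rightarrow> 'a vertex set \<Rightarrow> 'a set \<Rightarrow> real" where
  "matrix_entry M G e p =
     (if \<exists>A\<in>edge_partition M G e. \<exists>B\<in>edge_partition M G e.
           A \<noteq> B \<and> (\<exists>u\<in>A. \<exists>v\<in>B. p = {u, v})
      then 1 else 0)"

definition tree_polyhedron :: "'a set \<Rightarrow> 'a vertex graph \<Rightarrow> ('a set \<Rightarrow>\<^sub>0 real) set" where
  "tree_polyhedron M G =
     {x \<in> pair_space M.
        (\<forall>e\<in>edges G. (\<Sum>p\<in>pairs M. matrix_entry M G e p * Poly_Mapping.lookup x p) = 1) \<and>
        (\<forall>p\<in>pairs M. 0 \<le> Poly_Mapping.lookup x p)}"

definition vertices_of :: "'b::real_vector set \<Rightarrow> 'b set" where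
  "vertices_of X = {x. x extreme_point_of X}"

lemma mem_vertices_of_iff:
  "x \<in> vertices_of X \<longleftrightarrow> x \<in> X \<and>
     (\<forall>x0\<in>X. \<forall>x1\<in>X. \<forall>t. 0 < t \<and> t < 1 \<and> x = (1 - t) *\<^sub>R x0 + t *\<^sub>R x1 \<longrightarrow> x0 = x \<and> x1 = x)"
  (is "?L \<longleftrightarrow> ?R")
proof
  assume L: ?L
  have "x0 = x \<and> x1 = x"
    if "x0 \<in> X" "x1 \<in> X" "0 < t" "t < 1" and x: "x = (1 - t) *\<^sub>R x0 + t *\<^sub>R x1" for x0 x1 t
  proof -
    have "x \<notin> open_segment x0 x1"
      using L that by (auto simp: vertices_of_def extreme_point_of_def)
    with that have "x0 = x1"
      by (auto simp: in_segment)
    then show ?thesis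
      using x by (simp add: scaleR_left_distrib [symmetric])
  qed
  with L show ?R
    by (auto simp: vertices_of_def extreme_point_of_def)
next
  assume R: ?R
  have "x \<notin> open_segment a b" if "a \<in> X" "b \<in> X" for a b
  proof
    assume "x \<in> open_segment a b"
    then obtain u where "a \<noteq> b" "0 < u" "u < 1" "x = (1 - u) *\<^sub>R a + u *\<^sub>R b"
      unfolding in_segment by blast
    then have "a = x \<and> b = x"
      using R that by blast
    with \<open>a \<noteq> b\<close> show False
      by simp
  qed
  with R show ?L
    by (simp add: vertices_of_def extreme_point_of_def)
qed

definition all_tree_vertices :: "'a set \<Rightarrow> ('a set \<Rightarrow>\<^sub>0 real) set" where
  "all_tree_vertices M =
     (\<Union>G\<in>{G. binary_tree_connecting M G}. vertices_of (tree_polyhedron M G))"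

end

theory Submission
  imports Defs "HOL-Library.Transitive_Closure_Table"
begin

text \<open>
  Every point of every tree polyhedron \<open>W\<^sub>H\<close> satisfies \<^emph>\<open>all\<close> cut inequalities: for a subset \<open>A\<close> of
  \<open>M\<close> with \<open>A \<noteq> {}\<close> and \<open>A \<noteq> M\<close>, the coordinates of the pairs separated by \<open>A\<close> sum to at least 1
  (\<open>weight_cut_ge_1\<close>). For a fixed tree \<open>G\<close>, the splits of \<open>M\<close> given by the edges of \<open>G\<close> are among
  these cuts, so \<open>V\<close>, and with it the convex hull of \<open>V\<close>, lies in the polyhedron
  \<open>relaxation M G\<close>, in which the equations of \<open>W\<^sub>G\<close> are weakened to \<open>\<ge> 1\<close>. On the
  hull, \<open>W\<^sub>G\<close> is therefore cut out by equality in valid linear inequalities: a proper convex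
  combination of points of the hull can lie in \<open>W\<^sub>G\<close> only if all of them do. A vertex of
  \<open>W\<^sub>G\<close> is thus extreme in the hull as well. The converse inclusion holds for the convex hull of
  any set.

  The cut inequality is proved in the form known from matching theory. The pendant edges of \<open>H\<close>
  force the coordinates of the pairs containing a given leaf to sum to 1, so that the cut of \<open>A\<close> is
  \<open>|A|\<close> minus twice the weight of the pairs inside \<open>A\<close>, and it suffices that pairs inside \<open>A\<close>
  have total weight at most \<open>(|A| - 1) / 2\<close> (\<open>weight_inside\<close>). Root \<open>H\<close> at a leaf outside \<open>A\<close>. At
  each inner vertex, the equations of the three incident edges say that the leaf sets below its two
  children are joined by weight exactly \<open>1 / 2\<close> (\<open>weight_siblings\<close>). In an induction up the tree,
  two nonempty parts of \<open>A\<close> that meet at an inner vertex therefore add at most \<open>1 / 2\<close> to the weight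
  inside them, and \<open>(|A\<^sub>1| - 1) / 2 + (|A\<^sub>2| - 1) / 2 + 1 / 2 = (|A\<^sub>1| + |A\<^sub>2| - 1) / 2\<close>.
\<close>

section \<open>The two sides of an edge of a tree\<close>

abbreviation adjacent :: "'v graph \<Rightarrow> 'v \<Rightarrow> 'v \<Rightarrow> bool" where
  "adjacent G u v \<equiv> {u, v} \<in> edges G"

text \<open>
  An edge \<open>{u, v}\<close> together with the direction from \<open>u\<close> to \<open>v\<close>; when the tree is rooted on the side
  of \<open>u\<close>, the set \<open>side G u v\<close> is the subtree below \<open>v\<close>. All inductions on rooted subtrees are
  phrased with it, so that no subtree has to be built as a graph of its own.
\<close>

definition side :: "'v graph \<Rightarrow> 'v \<Rightarrow> 'v \<Rightarrow> 'v set" where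
  "side G u v = {w. reachable (remove_edge G {u, v}) v w}"

lemma reachable_refl [simp]: "reachable G u u"
  by (simp add: reachable_def)

lemma reachable_trans: "reachable G u v \<Longrightarrow> reachable G v w \<Longrightarrow> reachable G u w"
  by (simp add: reachable_def)

lemma reachable_step: "reachable G u v \<Longrightarrow> adjacent G v w \<Longrightarrow> reachable G u w"
  unfolding reachable_def by (rule rtranclp.rtrancl_into_rtrancl)

lemma reachable_sym: "reachable G u v \<Longrightarrow> reachable G v u"
  unfolding reachable_def
proof (induction rule: rtranclp_induct)
  case (step y z)
  then have "adjacent G z y"
    by (simp add: insert_commute)
  then show ?case
    using step.IH by (rule converse_rtranclp_into_rtranclp)
qed simp

lemma reachable_induct [consumes 1, case_names refl step]:
  assumes "reachable G u w" and "P u"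
    and "\<And>w w'. reachable G u w \<Longrightarrow> adjacent G w w' \<Longrightarrow> P w \<Longrightarrow> P w'"
  shows "P w"
  using assms(1)[unfolded reachable_def]
proof (induction rule: rtranclp_induct)
  case (step w w')
  show ?case
    by (rule assms(3)[OF _ step.hyps(2) step.IH]) (simp add: reachable_def step.hyps(1))
qed (rule assms(2))

lemma edges_remove_edge [simp]: "edges (remove_edge G e) = edges G - {e}"
  by (simp add: remove_edge_def)

lemma verts_remove_edge [simp]: "verts (remove_edge G e) = verts G"
  by (simp add: remove_edge_def)

lemma mem_side_self [simp]: "v \<in> side G u v"
  by (simp add: side_def)

lemma side_step: "w \<in> side G u v \<Longrightarrow> adjacent G w w' \<Longrightarrow> {w, w'} \<noteq> {u, v} \<Longrightarrow> w' \<in> side G u v"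
  using reachable_step[of "remove_edge G {u, v}" v w w'] by (simp add: side_def)

lemma side_induct [consumes 1, case_names self step]:
  assumes "w \<in> side G u v" and "P v"
    and "\<And>w w'. w \<in> side G u v \<Longrightarrow> w' \<in> side G u v \<Longrightarrow> adjacent G w w' \<Longrightarrow>
           {w, w'} \<noteq> {u, v} \<Longrightarrow> P w \<Longrightarrow> P w'"
  shows "P w"
proof -
  have "reachable (remove_edge G {u, v}) v w"
    using assms(1) by (simp add: side_def)
  then show ?thesis
  proof (induction rule: reachable_induct)
    case (step w w')
    then have *: "w \<in> side G u v" "adjacent G w w'" "{w, w'} \<noteq> {u, v}"
      by (simp_all add: side_def)
    show ?case
      by (rule assms(3)[OF *(1) side_step[OF *] *(2,3) step.IH])
  qed (rule assms(2))
qed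

locale finite_tree =
  fixes G :: "'v graph"
  assumes tree: "tree G"
begin

lemma finite_verts: "finite (verts G)"
  using tree by (simp add: tree_def simple_graph_def)

lemma edge_D:
  assumes "adjacent G u v"
  shows "u \<in> verts G" "v \<in> verts G" "u \<noteq> v"
proof -
  have "{u, v} \<subseteq> verts G" "card {u, v} = 2"
    using assms tree unfolding tree_def simple_graph_def by blast+
  then show "u \<in> verts G" "v \<in> verts G" "u \<noteq> v"
    by auto
qed

lemma edgeE:
  assumes "e \<in> edges G"
  obtains u v where "e = {u, v}" "adjacent G u v"
  using assms tree unfolding tree_def simple_graph_def by (metis card_2_iff)

lemma connected: "u \<in> verts G \<Longrightarrow> v \<in> verts G \<Longrightarrow> reachable G u v"
  using tree by (auto simp: tree_def connected_graph_def)

text \<open>A path from \<open>v\<close> back to \<open>u\<close> that avoids the edge \<open>{u, v}\<close> would be closed to a cycle by this edge.\<close>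

lemma notin_side:
  assumes "adjacent G u v"
  shows "u \<notin> side G u v"
proof
  assume "u \<in> side G u v"
  let ?R = "adjacent (remove_edge G {u, v})"
  have "?R\<^sup>*\<^sup>* v u"
    using \<open>u \<in> side G u v\<close> by (simp add: side_def reachable_def)
  then obtain ws where "rtrancl_path ?R v ws u"
    by (auto simp: rtranclp_eq_rtrancl_path)
  then obtain xs where path: "rtrancl_path ?R v xs u" and dist: "distinct (v # xs)"
    by (rule rtrancl_path_distinct)
  have "u \<noteq> v"
    using edge_D[OF assms] by simp
  have step: "?R ((v # xs) ! i) (xs ! i)" if "i < length xs" for i
    using rtrancl_path_nth[OF path that] .
  have "xs \<noteq> []"
    using path \<open>u \<noteq> v\<close> by (auto elim: rtrancl_path.cases)
  then have last: "last xs = u"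
    using rtrancl_path_last[OF path] by simp
  have "length xs \<noteq> 1"
  proof
    assume "length xs = 1"
    then obtain y where "xs = [y]"
      by (auto simp: length_Suc_conv)
    then show False
      using step[of 0] last by (auto simp: insert_commute)
  qed
  then have "3 \<le> length (v # xs)"
    using \<open>xs \<noteq> []\<close> by (cases xs) (auto simp: Suc_le_eq)
  then have "cycle G (v # xs)"
    using dist step last \<open>xs \<noteq> []\<close> assms by (auto simp: cycle_def)
  then show False
    using tree by (auto simp: tree_def)
qed

lemma side_subset:
  assumes "adjacent G u v"
  shows "side G u v \<subseteq> verts G"
proof
  fix w assume "w \<in> side G u v"
  then show "w \<in> verts G"
    by (induction rule: side_induct) (use edge_D assms in blast)+
qed

lemma verts_eq_sides:
  assumes "adjacent G u v"
  shows "verts G = side G u v \<union> side G v u"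
proof
  show "verts G \<subseteq> side G u v \<union> side G v u"
  proof
    fix w assume "w \<in> verts G"
    then have "reachable G v w"
      using connected edge_D[OF assms] by blast
    then show "w \<in> side G u v \<union> side G v u"
    proof (induction rule: reachable_induct)
      case (step w w')
      show ?case
      proof (cases "{w, w'} = {u, v}")
        case True
        then have "w' = u \<or> w' = v"
          by blast
        then show ?thesis
          by auto
      next
        case False
        then have "{w, w'} \<noteq> {v, u}"
          by (simp add: insert_commute)
        then have "w' \<in> side G v u" if "w \<in> side G v u"
          by (rule side_step[OF that step.hyps(2)])
        moreover have "w' \<in> side G u v" if "w \<in> side G u v"
          by (rule side_step[OF that step.hyps(2) False])
        ultimately show ?thesis
          using step.IH by blast
      qed
    qed simp
  qed
  show "side G u v \<union> side G v u \<subseteq> verts G"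
    using side_subset[OF assms] side_subset[of v u] assms by (simp add: insert_commute)
qed

lemma sides_disjoint:
  assumes "adjacent G u v"
  shows "side G u v \<inter> side G v u = {}"
proof -
  have False if "w \<in> side G u v" "w \<in> side G v u" for w
  proof -
    have "reachable (remove_edge G {u, v}) v w" "reachable (remove_edge G {u, v}) u w"
      using that unfolding side_def insert_commute[of v u "{}"] by simp_all
    then have "reachable (remove_edge G {u, v}) v u"
      by (rule reachable_trans[OF _ reachable_sym])
    then have "u \<in> side G u v"
      by (simp add: side_def)
    then show False
      using notin_side[OF assms] by blast
  qed
  then show ?thesis
    by blast
qed

lemma components_remove_edge:
  assumes "adjacent G u v"
  shows "components (remove_edge G {u, v}) = {side G u v, side G v u}"
proof -
  let ?H = "remove_edge G {u, v}"
  have cls: "{w' \<in> verts G. reachable ?H w w'} = verts G \<inter> {w'. reachable ?H c w'}"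
    if "reachable ?H c w" for c w
  proof -
    have "reachable ?H w w' \<longleftrightarrow> reachable ?H c w'" for w'
      using reachable_trans[OF that, of w'] reachable_trans[OF reachable_sym[OF that], of w'] by argo
    then show ?thesis
      by blast
  qed
  have comp: "{w' \<in> verts G. reachable ?H w w'} =
      (if w \<in> side G u v then side G u v else side G v u)" if "w \<in> verts G" for w
  proof (cases "w \<in> side G u v")
    case True
    then have "reachable ?H v w"
      by (simp add: side_def)
    then have "{w' \<in> verts G. reachable ?H w w'} = verts G \<inter> side G u v"
      unfolding side_def by (rule cls)
    then show ?thesis
      using True verts_eq_sides[OF assms] by auto
  next
    case False
    then have "w \<in> side G v u"
      using that verts_eq_sides[OF assms] by blast
    then have "reachable ?H u w"
      unfolding side_def insert_commute[of v u "{}"] by simp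
    then have "{w' \<in> verts G. reachable ?H w w'} = verts G \<inter> side G v u"
      unfolding side_def insert_commute[of v u "{}"] by (rule cls)
    then show ?thesis
      using False verts_eq_sides[OF assms] by auto
  qed
  define f where "f = (\<lambda>w. if w \<in> side G u v then side G u v else side G v u)"
  have "components ?H = f ` verts G"
    unfolding components_def verts_remove_edge f_def by (rule image_cong[OF refl comp])
  also have "\<dots> = {side G u v, side G v u}"
  proof
    show "f ` verts G \<subseteq> {side G u v, side G v u}"
      by (auto simp: f_def)
    have "side G u v = f v" "side G v u = f u"
      using notin_side[OF assms] by (simp_all add: f_def)
    then show "{side G u v, side G v u} \<subseteq> f ` verts G"
      using edge_D(1,2)[OF assms] by simp
  qed
  finally show ?thesis .
qed

text \<open>
  A walk that leaves \<open>v\<close> along \<open>{v, a}\<close> and does not use this edge again never returns to \<open>v\<close>, hence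
  it cannot use \<open>{u, v}\<close>.
\<close>

lemma side_branch:
  assumes "adjacent G u v" "adjacent G v a" "a \<noteq> u"
  shows "side G v a \<subseteq> side G u v - {v}"
proof
  fix w assume "w \<in> side G v a"
  have v: "v \<notin> side G v a"
    using notin_side assms by blast
  show "w \<in> side G u v - {v}"
    using \<open>w \<in> side G v a\<close>
  proof (induction rule: side_induct)
    case self
    have "{v, a} \<noteq> {u, v}"
      using \<open>a \<noteq> u\<close> by (simp add: doubleton_eq_iff)
    then have "a \<in> side G u v"
      by (rule side_step[OF mem_side_self assms(2)])
    then show ?case
      using edge_D(3)[OF assms(2)] by simp
  next
    case (step w w')
    then have "w \<noteq> v" "w' \<noteq> v"
      using v by auto
    then have "{w, w'} \<noteq> {u, v}"
      by (auto simp: doubleton_eq_iff)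
    then have "w' \<in> side G u v"
      using step.IH by (intro side_step[OF _ step.hyps(3)]) simp_all
    then show ?case
      using \<open>w' \<noteq> v\<close> by simp
  qed
qed

lemma branches_disjoint:
  assumes "adjacent G v a" "adjacent G v b" "a \<noteq> b"
  shows "side G v a \<inter> side G v b = {}"
proof -
  have "side G v b \<subseteq> side G a v"
    using side_branch[of a v b] assms by (simp add: insert_commute subset_Diff_insert)
  then show ?thesis
    using sides_disjoint[OF assms(1)] by blast
qed

text \<open>The set \<open>N\<close> plays the part of the children of \<open>v\<close>; it is empty when \<open>v\<close> is a leaf.\<close>

lemma side_decompose:
  assumes nb: "\<And>w. adjacent G v w \<Longrightarrow> w \<noteq> u \<Longrightarrow> w \<in> N"
  shows "side G u v \<subseteq> insert v (\<Union>a\<in>N. side G v a)"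
proof
  fix w assume "w \<in> side G u v"
  then show "w \<in> insert v (\<Union>a\<in>N. side G v a)"
  proof (induction rule: side_induct)
    case (step w w')
    show ?case
    proof (cases "w = v")
      case True
      then have "adjacent G v w'" "w' \<noteq> u"
        using step.hyps by (auto simp: insert_commute)
      then have "w' \<in> N"
        by (rule nb)
      then show ?thesis
        using mem_side_self[of w' G v] by blast
    next
      case False
      then obtain a where a: "a \<in> N" "w \<in> side G v a"
        using step.IH by blast
      show ?thesis
      proof (cases "w' = v")
        case False
        then have "{w, w'} \<noteq> {v, a}"
          using \<open>w \<noteq> v\<close> by (simp add: doubleton_eq_iff)
        then have "w' \<in> side G v a"
          by (rule side_step[OF a(2) step.hyps(3)])
        then show ?thesis
          using a(1) by blast
      qed simp
    qed
  qed simp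
qed

lemma degree_eq_card_neighbours: "degree G v = card {w. adjacent G v w}"
proof -
  have "bij_betw (\<lambda>w. {v, w}) {w. adjacent G v w} {e \<in> edges G. v \<in> e}"
    unfolding bij_betw_def
  proof
    show "inj_on (\<lambda>w. {v, w}) {w. adjacent G v w}"
      by (auto simp: inj_on_def doubleton_eq_iff)
    have "e \<in> (\<lambda>w. {v, w}) ` {w. adjacent G v w}" if "e \<in> edges G" "v \<in> e" for e
    proof -
      obtain a b where "e = {a, b}" "adjacent G a b"
        using \<open>e \<in> edges G\<close> by (rule edgeE)
      then show ?thesis
        using \<open>v \<in> e\<close> by (auto simp: insert_commute)
    qed
    then show "(\<lambda>w. {v, w}) ` {w. adjacent G v w} = {e \<in> edges G. v \<in> e}"
      by auto
  qed
  then show ?thesis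
    unfolding degree_def by (simp add: bij_betw_same_card)
qed

end


section \<open>Weights between sets of leaves\<close>

text \<open>
  The sum is over ordered pairs: \<open>weight x A B\<close> is the weight between \<open>A\<close> and \<open>B\<close> if these
  are disjoint, but \<open>weight x A A\<close> counts each pair inside \<open>A\<close> twice. The terms with \<open>i = j\<close> vanish
  for points of \<open>\<real>\<^sup>N\<close>, since a singleton is not an index of a coordinate.
\<close>

definition weight :: "('a set \<Rightarrow>\<^sub>0 real) \<Rightarrow> 'a set \<Rightarrow> 'a set \<Rightarrow> real" where
  "weight x A B = (\<Sum>i\<in>A. \<Sum>j\<in>B. Poly_Mapping.lookup x {i, j})"

lemma weight_commute: "weight x A B = weight x B A"
  unfolding weight_def by (subst sum.swap) (simp add: insert_commute)

lemma weight_Un_right: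
  assumes "finite B" "finite C" "B \<inter> C = {}"
  shows "weight x A (B \<union> C) = weight x A B + weight x A C"
  using assms by (simp add: weight_def sum.union_disjoint sum.distrib)

lemma weight_Un_left:
  assumes "finite B" "finite C" "B \<inter> C = {}"
  shows "weight x (B \<union> C) A = weight x B A + weight x C A"
  using weight_Un_right[OF assms] by (simp add: weight_commute)

lemma weight_mono:
  assumes "finite A'" "finite B'" "A \<subseteq> A'" "B \<subseteq> B'"
    and "\<And>p. 0 \<le> Poly_Mapping.lookup x p"
  shows "weight x A B \<le> weight x A' B'"
  unfolding weight_def
  using assms by (intro sum_mono2 order.trans[OF sum_mono sum_mono2]) (auto intro: sum_nonneg)

lemma sum_separated_pairs:
  assumes "finite M" "A \<subseteq> M"
  shows "(\<Sum>p\<in>pairs M. (if \<exists>u\<in>A. \<exists>v\<in>M - A. p = {u, v} then 1 else 0) * Poly_Mapping.lookup x p)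
    = weight x A (M - A)"
proof -
  have fin: "finite (pairs M)"
    by (rule finite_subset[of _ "Pow M"]) (auto simp: pairs_def assms)
  have img: "{p \<in> pairs M. \<exists>u\<in>A. \<exists>v\<in>M - A. p = {u, v}} = (\<lambda>(i, j). {i, j}) ` (A \<times> (M - A))"
    (is "?L = ?R")
  proof
    show "?L \<subseteq> ?R"
      by auto
    have "{i, j} \<in> pairs M" if "i \<in> A" "j \<in> M - A" for i j
      using that assms(2) unfolding pairs_def by blast
    then show "?R \<subseteq> ?L"
      by auto
  qed
  have inj: "inj_on (\<lambda>(i, j). {i, j}) (A \<times> (M - A))"
    by (auto simp: inj_on_def doubleton_eq_iff)
  have "(\<Sum>p\<in>pairs M. (if \<exists>u\<in>A. \<exists>v\<in>M - A. p = {u, v} then 1 else 0) * Poly_Mapping.lookup x p)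
      = (\<Sum>p\<in>{p \<in> pairs M. \<exists>u\<in>A. \<exists>v\<in>M - A. p = {u, v}}. Poly_Mapping.lookup x p)"
    using fin by (subst sum.inter_filter) (auto intro!: sum.cong)
  also have "\<dots> = (\<Sum>(i, j)\<in>A \<times> (M - A). Poly_Mapping.lookup x {i, j})"
    unfolding img by (subst sum.reindex[OF inj]) (simp add: case_prod_unfold)
  also have "\<dots> = weight x A (M - A)"
    unfolding weight_def by (simp add: sum.cartesian_product)
  finally show ?thesis .
qed


section \<open>The polyhedron of a tree in terms of cuts\<close>

locale binary_tree = finite_tree G for G :: "'a vertex graph" +
  fixes M :: "'a set"
  assumes fin: "finite M"
    and binary: "binary_tree_connecting M G"
begin

definition leaves :: "'a vertex \<Rightarrow> 'a vertex \<Rightarrow> 'a set" where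
  "leaves u v = {m \<in> M. Inl m \<in> side G u v}"

lemma leaf_in_verts: "m \<in> M \<Longrightarrow> Inl m \<in> verts G"
  using binary by (auto simp: binary_tree_connecting_def)

lemma degree_leaf: "m \<in> M \<Longrightarrow> degree G (Inl m) = 1"
  using binary by (auto simp: binary_tree_connecting_def)

lemma degree_inner: "v \<in> verts G \<Longrightarrow> v \<notin> Inl ` M \<Longrightarrow> degree G v = 3"
  using binary by (auto simp: binary_tree_connecting_def)

lemma leaves_subset: "leaves u v \<subseteq> M"
  by (auto simp: leaves_def)

lemma finite_leaves [simp]: "finite (leaves u v)"
  using fin leaves_subset finite_subset by blast

lemma leaves_flip:
  assumes "adjacent G u v"
  shows "leaves v u = M - leaves u v"
  using verts_eq_sides[OF assms] sides_disjoint[OF assms] leaf_in_verts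
  by (auto simp: leaves_def)

lemma matrix_entry_edge:
  assumes "adjacent G u v"
  shows "matrix_entry M G {u, v} p =
    (if \<exists>i\<in>leaves u v. \<exists>j\<in>M - leaves u v. p = {i, j} then 1 else 0)"
proof -
  have part: "edge_partition M G {u, v} = {leaves u v, M - leaves u v}"
    unfolding edge_partition_def components_remove_edge[OF assms] leaves_flip[OF assms, symmetric]
    by (simp add: leaves_def)
  have iff: "(\<exists>A\<in>edge_partition M G {u, v}. \<exists>B\<in>edge_partition M G {u, v}.
           A \<noteq> B \<and> (\<exists>u\<in>A. \<exists>v\<in>B. p = {u, v})) \<longleftrightarrow>
        (\<exists>i\<in>leaves u v. \<exists>j\<in>M - leaves u v. p = {i, j})"
    unfolding part by (auto simp: insert_commute)
  show ?thesis
    unfolding matrix_entry_def iff ..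
qed

lemma matrix_row_edge:
  assumes "adjacent G u v"
  shows "(\<Sum>p\<in>pairs M. matrix_entry M G {u, v} p * Poly_Mapping.lookup x p)
    = weight x (leaves u v) (M - leaves u v)"
  unfolding matrix_entry_edge[OF assms]
  by (rule sum_separated_pairs[OF fin leaves_subset])

end


section \<open>Points of the polyhedron of a tree satisfy all cut inequalities\<close>

locale tree_polyhedron_point = binary_tree G M for G :: "'a vertex graph" and M +
  fixes x :: "'a set \<Rightarrow>\<^sub>0 real"
  assumes point: "x \<in> tree_polyhedron M G"
begin

lemma lookup_eq_0: "p \<notin> pairs M \<Longrightarrow> Poly_Mapping.lookup x p = 0"
  using point by (auto simp: tree_polyhedron_def pair_space_def in_keys_iff)

lemma lookup_nonneg: "0 \<le> Poly_Mapping.lookup x p"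
  using point lookup_eq_0[of p] by (cases "p \<in> pairs M") (auto simp: tree_polyhedron_def)

lemma weight_singleton: "weight x {i} {i} = 0"
  unfolding weight_def by (simp add: lookup_eq_0 pairs_def)

lemma weight_edge:
  assumes "adjacent G u v"
  shows "weight x (leaves u v) (M - leaves u v) = 1"
  using point assms by (auto simp: matrix_row_edge[OF assms, symmetric] tree_polyhedron_def)

lemma leaf_neighbour:
  assumes "m \<in> M"
  obtains v where "\<And>w. adjacent G (Inl m) w \<longleftrightarrow> w = v"
proof -
  obtain v where "{w. adjacent G (Inl m) w} = {v}"
    using degree_leaf[OF assms] by (auto simp: degree_eq_card_neighbours card_1_singleton_iff)
  then have "adjacent G (Inl m) w \<longleftrightarrow> w = v" for w
    by (simp add: set_eq_iff)
  then show ?thesis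
    by (rule that)
qed

lemma leaves_leaf:
  assumes "m \<in> M" "adjacent G v (Inl m)"
  shows "leaves v (Inl m) = {m}"
proof -
  obtain v' where v': "\<And>w. adjacent G (Inl m) w \<longleftrightarrow> w = v'"
    using assms(1) by (rule leaf_neighbour) blast
  have "adjacent G (Inl m) v"
    using assms(2) by (simp add: insert_commute)
  then have "w = v" if "adjacent G (Inl m) w" for w
    using that v' by simp
  then have "side G v (Inl m) \<subseteq> insert (Inl m) (\<Union>a\<in>{}. side G (Inl m) a)"
    by (intro side_decompose) blast
  then show ?thesis
    using assms(1) by (auto simp: leaves_def)
qed

lemma weight_leaf:
  assumes "m \<in> M"
  shows "weight x {m} M = 1"
proof -
  obtain v where "\<And>w. adjacent G (Inl m) w \<longleftrightarrow> w = v"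
    using assms by (rule leaf_neighbour) blast
  then have "adjacent G (Inl m) v"
    by simp
  then have v: "adjacent G v (Inl m)"
    by (simp add: insert_commute)
  have "weight x {m} (M - {m}) = 1"
    using weight_edge[OF v] leaves_leaf[OF assms v] by simp
  moreover have "weight x {m} ((M - {m}) \<union> {m}) = weight x {m} (M - {m}) + weight x {m} {m}"
    using fin by (intro weight_Un_right) auto
  moreover have "(M - {m}) \<union> {m} = M"
    using assms by blast
  ultimately show ?thesis
    by (simp add: weight_singleton)
qed

text \<open>
  Consequently \<open>weight x S (M - S) = |S| - weight x S S\<close>, which turns lower bounds for cuts into
  upper bounds for the weight inside a set.
\<close>

lemma weight_total:
  assumes "S \<subseteq> M"
  shows "weight x S M = real (card S)"
proof -
  have "weight x S M = (\<Sum>i\<in>S. weight x {i} M)"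
    by (simp add: weight_def)
  also have "\<dots> = (\<Sum>i\<in>S. 1)"
    using assms by (intro sum.cong) (auto intro: weight_leaf)
  finally show ?thesis
    by simp
qed

lemma leaves_branch:
  assumes uv: "adjacent G u v" and nb: "{w. adjacent G v w} = {u, a, b}"
    and dist: "u \<noteq> a" "u \<noteq> b" "a \<noteq> b"
  shows "leaves u v = leaves v a \<union> leaves v b" "leaves v a \<inter> leaves v b = {}"
proof -
  have adj: "adjacent G v a" "adjacent G v b"
    using nb by blast+
  have "degree G v = 3"
    using dist by (simp add: degree_eq_card_neighbours nb)
  then have "v \<notin> Inl ` M"
    using degree_leaf by auto
  moreover have "side G u v \<subseteq> insert v (\<Union>c\<in>{a, b}. side G v c)"
    using nb by (intro side_decompose) blast
  moreover have "side G v a \<subseteq> side G u v" "side G v b \<subseteq> side G u v"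
    using side_branch[OF uv adj(1)] side_branch[OF uv adj(2)] dist by auto
  ultimately show "leaves u v = leaves v a \<union> leaves v b"
    unfolding leaves_def by blast
  show "leaves v a \<inter> leaves v b = {}"
    using branches_disjoint[OF adj \<open>a \<noteq> b\<close>] by (auto simp: leaves_def)
qed

text \<open>
  The three branches at an inner vertex partition \<open>M\<close>, and each of them is joined to the other two
  by weight 1. The three resulting equations for the three weights between two branches have the
  unique solution \<open>1 / 2\<close>.
\<close>

lemma weight_siblings:
  assumes uv: "adjacent G u v" and nb: "{w. adjacent G v w} = {u, a, b}"
    and dist: "u \<noteq> a" "u \<noteq> b" "a \<noteq> b"
  shows "weight x (leaves v a) (leaves v b) = 1 / 2"
proof -
  let ?B = "leaves v a" and ?C = "leaves v b" and ?D = "M - leaves u v"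
  note A = leaves_branch[OF assms]
  have adj: "adjacent G v a" "adjacent G v b"
    using nb by blast+
  have D: "finite ?D" "?B \<inter> ?D = {}" "?C \<inter> ?D = {}"
    using fin A by auto
  have "M - ?B = ?C \<union> ?D" "M - ?C = ?B \<union> ?D"
    using A leaves_subset[of v a] leaves_subset[of v b] by auto
  then have "weight x ?B (?C \<union> ?D) = 1" "weight x ?C (?B \<union> ?D) = 1"
    using weight_edge[OF adj(1)] weight_edge[OF adj(2)] by simp_all
  then have "weight x ?B ?C + weight x ?B ?D = 1" "weight x ?C ?B + weight x ?C ?D = 1"
    using D by (simp_all add: weight_Un_right)
  moreover have "weight x ?B ?D + weight x ?C ?D = 1"
    using weight_edge[OF uv] A by (simp add: weight_Un_left)
  ultimately show ?thesis
    using weight_commute[of x ?B ?C] by linarith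
qed

text \<open>
  Induction over rooted subtrees. The choice of \<open>S\<close> as an arbitrary nonempty subset of
  the leaves, and not just the set of leaves below \<open>v\<close>, is what makes the bound apply to cuts that are
  unrelated to the tree. In terms of unordered pairs, it is the bound \<open>(|S| - 1) / 2\<close>.
\<close>

lemma weight_inside:
  assumes "adjacent G u v" "S \<subseteq> leaves u v" "S \<noteq> {}"
  shows "weight x S S \<le> real (card S) - 1"
  using assms
proof (induction "card (side G u v)" arbitrary: u v S rule: less_induct)
  case less
  note uv = less.prems(1)
  show ?case
  proof (cases "v \<in> Inl ` M")
    case True
    then obtain m where m: "m \<in> M" "v = Inl m"
      by blast
    then have "S = {m}"
      using leaves_leaf[of m u] less.prems by auto
    then show ?thesis
      by (simp add: weight_singleton)
  next
    case False
    let ?N = "{w. adjacent G v w}"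
    have "card ?N = 3"
      using degree_inner[OF edge_D(2)[OF uv] False] by (simp add: degree_eq_card_neighbours)
    moreover have "u \<in> ?N"
      using uv by (simp add: insert_commute)
    ultimately have "card (?N - {u}) = 2"
      by simp
    then obtain a b where ab: "?N - {u} = {a, b}" "a \<noteq> b"
      by (auto simp: card_2_iff)
    have nb: "?N = {u, a, b}"
      using ab(1) \<open>u \<in> ?N\<close> by blast
    have dist: "u \<noteq> a" "u \<noteq> b"
      using ab(1) by blast+
    have adj: "adjacent G v a" "adjacent G v b"
      using nb by blast+
    note A = leaves_branch[OF uv nb dist ab(2)]
    have smaller: "card (side G v c) < card (side G u v)" if "adjacent G v c" "c \<noteq> u" for c
    proof (rule psubset_card_mono)
      show "finite (side G u v)"
        using side_subset[OF uv] finite_verts by (rule finite_subset)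
      show "side G v c \<subset> side G u v"
        using side_branch[OF uv that] mem_side_self[of v G u] by blast
    qed
    have IH: "weight x T T \<le> real (card T) - 1"
      if "adjacent G v c" "c \<noteq> u" "T \<subseteq> leaves v c" "T \<noteq> {}" for c T
      using less.hyps[OF smaller] that by blast
    define S1 where "S1 = S \<inter> leaves v a"
    define S2 where "S2 = S \<inter> leaves v b"
    have S: "S = S1 \<union> S2" "S1 \<inter> S2 = {}" "finite S1" "finite S2"
      using less.prems(2) A by (auto simp: S1_def S2_def)
    show ?thesis
    proof (cases "S1 = {} \<or> S2 = {}")
      case True
      then have "S \<subseteq> leaves v a \<or> S \<subseteq> leaves v b"
        using S(1) S1_def S2_def by blast
      then show ?thesis
        using IH[OF adj(1) _ _ less.prems(3)] IH[OF adj(2) _ _ less.prems(3)] dist by auto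
    next
      case False
      have "weight x S S = weight x S1 S1 + weight x S2 S2 + 2 * weight x S1 S2"
        using S weight_commute[of x S1 S2] by (simp add: weight_Un_left weight_Un_right)
      moreover have "weight x S1 S1 \<le> real (card S1) - 1"
        using False dist adj by (intro IH[of a]) (auto simp: S1_def)
      moreover have "weight x S2 S2 \<le> real (card S2) - 1"
        using False dist adj by (intro IH[of b]) (auto simp: S2_def)
      moreover have "weight x S1 S2 \<le> 1 / 2"
        unfolding weight_siblings[OF uv nb dist ab(2), symmetric]
        by (rule weight_mono) (auto simp: S1_def S2_def lookup_nonneg)
      moreover have "card S = card S1 + card S2"
        using S by (simp add: card_Un_disjoint)
      ultimately show ?thesis
        by simp
    qed
  qed
qed

text \<open>
  Rooting the tree at a leaf outside \<open>A\<close> makes all of \<open>A\<close> lie in the subtree below the root. At an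
  arbitrary edge with parts of \<open>A\<close> on both sides, the weight between the two parts is only bounded by
  1, which is not enough.
\<close>

lemma weight_cut_ge_1:
  assumes "A \<subseteq> M" "A \<noteq> {}" "A \<noteq> M"
  shows "1 \<le> weight x A (M - A)"
proof -
  obtain m where m: "m \<in> M" "m \<notin> A"
    using assms by blast
  obtain v where "\<And>w. adjacent G (Inl m) w \<longleftrightarrow> w = v"
    using m(1) by (rule leaf_neighbour) blast
  then have v: "adjacent G (Inl m) v"
    by simp
  then have "adjacent G v (Inl m)"
    by (simp add: insert_commute)
  then have "leaves (Inl m) v = M - {m}"
    using leaves_flip leaves_leaf m(1) by metis
  then have "weight x A A \<le> real (card A) - 1"
    using assms m by (intro weight_inside[OF v]) auto
  moreover have "weight x A (A \<union> (M - A)) = weight x A A + weight x A (M - A)"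
    using assms fin finite_subset by (intro weight_Un_right) auto
  moreover have "A \<union> (M - A) = M"
    using assms by blast
  ultimately show ?thesis
    using weight_total[OF assms(1)] by simp
qed

end


section \<open>Extremality\<close>

definition cut_sum :: "'a set \<Rightarrow> 'a vertex graph \<Rightarrow> 'a vertex set \<Rightarrow> ('a set \<Rightarrow>\<^sub>0 real) \<Rightarrow> real" where
  "cut_sum M G e x = (\<Sum>p\<in>pairs M. matrix_entry M G e p * Poly_Mapping.lookup x p)"

text \<open>A convex set that, unlike \<open>W\<^sub>G\<close> itself, contains the polyhedra of all the other trees.\<close>

definition relaxation :: "'a set \<Rightarrow> 'a vertex graph \<Rightarrow> ('a set \<Rightarrow>\<^sub>0 real) set" where
  "relaxation M G = {x \<in> pair_space M. (\<forall>e\<in>edges G. 1 \<le> cut_sum M G e x) \<and>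
     (\<forall>p\<in>pairs M. 0 \<le> Poly_Mapping.lookup x p)}"

lemma lookup_scaleR: "Poly_Mapping.lookup (c *\<^sub>R x) p = c *\<^sub>R Poly_Mapping.lookup x p"
proof -
  have "finite {p. c *\<^sub>R Poly_Mapping.lookup x p \<noteq> 0}"
    by (rule finite_subset[OF _ finite_lookup[of x]]) auto
  then show ?thesis
    by (simp add: scaleR_poly_mapping_def)
qed

lemma cut_sum_linear: "cut_sum M G e (c *\<^sub>R x + d *\<^sub>R y) = c * cut_sum M G e x + d * cut_sum M G e y"
  by (simp add: cut_sum_def lookup_add lookup_scaleR distrib_left sum.distrib sum_distrib_left
      mult.left_commute)

lemma mem_pair_space_iff: "x \<in> pair_space M \<longleftrightarrow> (\<forall>p. p \<notin> pairs M \<longrightarrow> Poly_Mapping.lookup x p = 0)"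
  by (auto simp: pair_space_def in_keys_iff)

lemma convex_relaxation: "convex (relaxation M G)"
proof (rule convexI)
  fix x y :: "'a set \<Rightarrow>\<^sub>0 real" and c d :: real
  assume xy: "x \<in> relaxation M G" "y \<in> relaxation M G" and cd: "0 \<le> c" "0 \<le> d" "c + d = 1"
  have "c *\<^sub>R x + d *\<^sub>R y \<in> pair_space M"
    using xy unfolding relaxation_def by (simp add: mem_pair_space_iff lookup_add lookup_scaleR)
  moreover have "1 \<le> cut_sum M G e (c *\<^sub>R x + d *\<^sub>R y)" if "e \<in> edges G" for e
  proof -
    have "c * 1 + d * 1 \<le> c * cut_sum M G e x + d * cut_sum M G e y"
      using xy that cd by (intro add_mono mult_left_mono) (auto simp: relaxation_def)
    then show ?thesis
      using cd by (simp add: cut_sum_linear)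
  qed
  ultimately show "c *\<^sub>R x + d *\<^sub>R y \<in> relaxation M G"
    using xy cd by (auto simp: relaxation_def lookup_add lookup_scaleR)
qed

lemma tree_polyhedron_iff:
  "x \<in> tree_polyhedron M G \<longleftrightarrow> x \<in> relaxation M G \<and> (\<forall>e\<in>edges G. cut_sum M G e x = 1)"
  unfolding tree_polyhedron_def relaxation_def cut_sum_def by auto

text \<open>
  The point \<open>x\<close> is there to make the splits of \<open>G\<close> proper: its weight across each
  split is 1, so neither part can be empty, and the cut inequality for \<open>y\<close> applies.
\<close>

lemma tree_polyhedra_in_relaxation:
  assumes fin: "finite M" and G: "binary_tree_connecting M G" and H: "binary_tree_connecting M H"
    and x: "x \<in> tree_polyhedron M G" and y: "y \<in> tree_polyhedron M H"
  shows "y \<in> relaxation M G"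
proof -
  interpret G: tree_polyhedron_point G M x
    using assms by unfold_locales (simp_all add: binary_tree_connecting_def)
  interpret H: tree_polyhedron_point H M y
    using assms by unfold_locales (simp_all add: binary_tree_connecting_def)
  have "1 \<le> cut_sum M G e y" if "e \<in> edges G" for e
  proof -
    obtain u v where e: "e = {u, v}" "adjacent G u v"
      using \<open>e \<in> edges G\<close> by (rule G.edgeE)
    let ?L = "G.leaves u v"
    have "weight x ?L (M - ?L) = 1"
      using e(2) by (rule G.weight_edge)
    then have "?L \<noteq> {}" "?L \<noteq> M"
      by (auto simp: weight_def)
    then have "1 \<le> weight y ?L (M - ?L)"
      using G.leaves_subset by (intro H.weight_cut_ge_1)
    then show ?thesis
      unfolding cut_sum_def e(1) G.matrix_row_edge[OF e(2)] .
  qed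
  then show ?thesis
    using y by (auto simp: relaxation_def tree_polyhedron_def)
qed

theorem mainTheorem1:
  fixes M :: "'a set"
  assumes "finite M"
  shows "all_tree_vertices M = vertices_of (convex hull (all_tree_vertices M))"
proof
  let ?V = "all_tree_vertices M"
  show "vertices_of (convex hull ?V) \<subseteq> ?V"
    using extreme_point_of_convex_hull by (auto simp: vertices_of_def)
  show "?V \<subseteq> vertices_of (convex hull ?V)"
  proof
    fix x assume "x \<in> ?V"
    then obtain G where G: "binary_tree_connecting M G" and x: "x \<in> vertices_of (tree_polyhedron M G)"
      by (auto simp: all_tree_vertices_def)
    have xW: "x \<in> tree_polyhedron M G"
      using x by (simp add: mem_vertices_of_iff)
    have "?V \<subseteq> relaxation M G"
      using tree_polyhedra_in_relaxation[OF assms G _ xW]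
      by (auto simp: all_tree_vertices_def mem_vertices_of_iff)
    then have hull: "convex hull ?V \<subseteq> relaxation M G"
      using convex_relaxation by (rule hull_minimal)
    have "x0 = x \<and> x1 = x"
      if in_hull: "x0 \<in> convex hull ?V" "x1 \<in> convex hull ?V" and t: "0 < t" "t < 1"
        and eq: "x = (1 - t) *\<^sub>R x0 + t *\<^sub>R x1" for x0 x1 t
    proof -
      have tight: "cut_sum M G e x0 = 1 \<and> cut_sum M G e x1 = 1" if "e \<in> edges G" for e
      proof -
        have ge: "1 \<le> cut_sum M G e x0" "1 \<le> cut_sum M G e x1"
          using in_hull hull that by (auto simp: relaxation_def)
        \<comment> \<open>A proper average of two numbers that are at least 1 equals 1 only if both do.\<close>
        have "(1 - t) * cut_sum M G e x0 + t * cut_sum M G e x1 = 1"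
          using xW that unfolding tree_polyhedron_iff eq cut_sum_linear by blast
        then have "(1 - t) * (cut_sum M G e x0 - 1) + t * (cut_sum M G e x1 - 1) = 0"
          by (simp add: algebra_simps)
        moreover have "0 \<le> (1 - t) * (cut_sum M G e x0 - 1)" "0 \<le> t * (cut_sum M G e x1 - 1)"
          using ge t by simp_all
        ultimately have "(1 - t) * (cut_sum M G e x0 - 1) = 0" "t * (cut_sum M G e x1 - 1) = 0"
          by linarith+
        then show ?thesis
          using t by simp
      qed
      then have "x0 \<in> tree_polyhedron M G" "x1 \<in> tree_polyhedron M G"
        using in_hull hull by (auto simp: tree_polyhedron_iff)
      then show ?thesis
        using x t eq unfolding mem_vertices_of_iff by blast
    qed
    then show "x \<in> vertices_of (convex hull ?V)"
      using \<open>x \<in> ?V\<close> by (auto simp: mem_vertices_of_iff intro: hull_inc)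
  qed
qed

end
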